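(* Let $G$ be a finite simple subcubic graph, let $e=uv\in E(G)$, and suppose that $G-e$ is connected. For every even cover $F$ of $G$ containing $e$, the graph $G-e$ admits a walk from $u$ to $v$ visiting every vertex of $G$, of length at most $|V(G)|+\mathrm{exc}(F)-3$. Consequently, $$\mathrm{OPT}(G-e,u,v)\le |V(G)|+\mathrm{exc}_e(G)-1 .$$
   Context: A graph is subcubic if its maximum degree is at most $3$. An even cover of $G$ is a spanning subgraph $F$ of $G$ in which every vertex has degree $0$ or $2$ (so $F$ is a disjoint union of cycles and isolated vertices); its excess is $\mathrm{exc}(F)=2\cdot(\text{number of cycles of }F)+(\text{number of isolated vertices of }F)$. For an edge $e$, $\mathcal E(G,e)$ is the set of even covers of $G$ containing $e$, and $\mathrm{exc}_e(G):=\min_{F\in\mathcal E(G,e)}\mathrm{exc}(F)-2$. For a connected graph $H$ and distinct vertices $u,v$, $\mathrm{OPT}(H,u,v)$ is the length (number of edges, counted with repetition) of a shortest walk in $H$ from $u$ to $v$ visiting every vertex of $H$ (repetitions allowed). *)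

theory Defs
  imports "Graph_Theory.Graph_Theory"
begin

text \<open>A finite simple graph is a \<^locale>\<open>pair_graph\<close>: a finite, loop-free, symmetric set of ordered
  pairs. An edge \<open>uv\<close> is the pair of arcs \<open>(u, v)\<close>, \<open>(v, u)\<close>, so the degree of a vertex is its
  out-degree.\<close>

definition subcubic :: "'a pair_pre_digraph \<Rightarrow> bool" where
  "subcubic G \<longleftrightarrow> (\<forall>w \<in> pverts G. out_degree G w \<le> 3)"

definition del_edge :: "'a pair_pre_digraph \<Rightarrow> 'a \<Rightarrow> 'a \<Rightarrow> 'a pair_pre_digraph" where
  "del_edge G u v = \<lparr> pverts = pverts G, parcs = parcs G - {(u, v), (v, u)} \<rparr>"

definition even_cover :: "'a pair_pre_digraph \<Rightarrow> 'a pair_pre_digraph \<Rightarrow> bool" where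
  "even_cover G F \<longleftrightarrow>
     pair_graph F \<and> spanning F G \<and> (\<forall>w \<in> pverts F. out_degree F w \<in> {0, 2})"

text \<open>A cycle is identified with its edge set (both orientations of each edge), so that its starting
  points and its two directions are not counted separately. The bound on the length excludes the
  closed walks \<open>a, b, a\<close>, which the library predicate admits in symmetric digraphs.\<close>

definition edge_cycles :: "'a pair_pre_digraph \<Rightarrow> 'a rel set" where
  "edge_cycles F = {set p \<union> (set p)\<inverse> | p. pre_digraph.cycle F p \<and> 3 \<le> length p}"

definition isolated_verts :: "'a pair_pre_digraph \<Rightarrow> 'a set" where
  "isolated_verts F = {w \<in> pverts F. out_degree F w = 0}"

definition exc :: "'a pair_pre_digraph \<Rightarrow> nat" where
  "exc F = 2 * card (edge_cycles F) + card (isolated_verts F)"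

definition even_covers_through :: "'a pair_pre_digraph \<Rightarrow> 'a \<Rightarrow> 'a \<Rightarrow> 'a pair_pre_digraph set" where
  "even_covers_through G u v = {F. even_cover G F \<and> (u, v) \<in> parcs F}"

text \<open>The minimum is over a finite set, which is nonempty exactly when the edge \<open>uv\<close> lies on a cycle,
  in particular when \<open>G - uv\<close> is connected. The value is an integer to avoid truncated subtraction.\<close>

definition exc_edge :: "'a pair_pre_digraph \<Rightarrow> 'a \<Rightarrow> 'a \<Rightarrow> int" where
  "exc_edge G u v = int (Min (exc ` even_covers_through G u v)) - 2"

definition covering_walk :: "'a pair_pre_digraph \<Rightarrow> 'a \<Rightarrow> ('a \<times> 'a) awalk \<Rightarrow> 'a \<Rightarrow> bool" where
  "covering_walk H u p v \<longleftrightarrow>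
     pre_digraph.awalk H u p v \<and> pverts H \<subseteq> set (pre_digraph.awalk_verts H u p)"

definition OPT :: "'a pair_pre_digraph \<Rightarrow> 'a \<Rightarrow> 'a \<Rightarrow> nat" where
  "OPT H u v = (LEAST n. \<exists>p. covering_walk H u p v \<and> length p = n)"

end

theory Submission
  imports Defs
begin

text \<open>
  Removing \<open>e\<close> from its cycle in \<open>F\<close> leaves a path from \<open>u\<close> to \<open>v\<close>. As long as a walk from \<open>u\<close> to \<open>v\<close>
  whose vertex set is a union of components of \<open>F\<close> misses a vertex, connectivity of \<open>G - e\<close> gives an
  arc \<open>(x, y)\<close> leaving it, and a detour at \<open>x\<close> through the component of \<open>y\<close> (once around the cycle and
  back to \<open>x\<close>) adds two arcs plus the length of that cycle. This is paid for by the new vertices and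
  the contribution \<open>2\<close> of the cycle to the excess, or, at an isolated vertex, by \<open>1 + 1\<close>.
\<close>

section \<open>Vertex lists as walks\<close>

lemma set_vwalk_arcs_subset: "set (vwalk_arcs xs) \<subseteq> set xs \<times> set xs"
  by (induct xs rule: vwalk_arcs.induct) auto

lemma length_vwalk_arcs: "length (vwalk_arcs xs) = length xs - 1"
  by (induct xs rule: vwalk_arcs.induct) auto

lemma pawalk_verts_vwalk_arcs:
  "xs \<noteq> [] \<Longrightarrow> pawalk_verts (hd xs) (vwalk_arcs xs) = xs"
  by (induct xs rule: vwalk_arcs.induct) auto

lemma (in pair_wf_digraph) awalk_vwalk_arcs:
  assumes "vwalk xs G"
  shows "awalk (hd xs) (vwalk_arcs xs) (last xs)"
  using assms by (induct) (auto simp: awalk_simps)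

lemma vwalk_insert_detour:
  assumes "vwalk (as @ x # bs) (with_proj H)" "vwalk ys (with_proj H)"
    and "(x, hd ys) \<in> parcs H" "(last ys, x) \<in> parcs H"
  shows "vwalk (as @ x # ys @ x # bs) (with_proj H)"
proof -
  have "ys \<noteq> []" using assms(2) by auto
  then show ?thesis
    using assms by (cases "as = []") (auto simp: vwalk_def vwalk_arcs_append)
qed

section \<open>Cycles as vertex lists\<close>

text \<open>Repeating the head closes the list; taking both orientations gives the form of the
  members of \<open>edge_cycles\<close>, independent of starting point and direction.\<close>

definition ring_arcs :: "'a list \<Rightarrow> 'a rel" where
  "ring_arcs xs = set (vwalk_arcs (xs @ [hd xs])) \<union> (set (vwalk_arcs (xs @ [hd xs])))\<inverse>"

lemma ring_arcs_conv:
  assumes "xs \<noteq> []"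
  shows "ring_arcs xs = (let A = insert (last xs, hd xs) (set (vwalk_arcs xs)) in A \<union> A\<inverse>)"
  using assms by (simp add: ring_arcs_def set_vwalk_arcs_snoc Let_def)

lemma sym_ring_arcs: "sym (ring_arcs xs)"
  by (auto simp: ring_arcs_def sym_def)

lemma ring_arcs_subset:
  assumes "xs \<noteq> []"
  shows "ring_arcs xs \<subseteq> set xs \<times> set xs"
  using assms set_vwalk_arcs_subset[of xs] by (auto simp: ring_arcs_conv Let_def)

lemma ring_arcs_subset_parcs:
  assumes "pair_graph G" "xs \<noteq> []" "set (vwalk_arcs xs) \<subseteq> parcs G" "(last xs, hd xs) \<in> parcs G"
  shows "ring_arcs xs \<subseteq> parcs G"
proof -
  interpret pair_graph G by fact
  show ?thesis using assms arcs_symmetric by (auto simp: ring_arcs_conv Let_def)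
qed

text \<open>Either order has the inner arcs of \<open>as\<close> and \<open>bs\<close> plus the two
  junctions between them. This allows any vertex of a ring to be put first.\<close>

lemma ring_arcs_rotate:
  assumes "as \<noteq> []" "bs \<noteq> []"
  shows "ring_arcs (as @ bs) = ring_arcs (bs @ as)"
  using assms by (simp add: ring_arcs_conv Let_def vwalk_arcs_append) blast

text \<open>After rotating \<open>w\<close> to the front, its neighbours are the second and the last
  vertex, which differ because at least two vertices remain besides \<open>w\<close>.\<close>

lemma ring_arcs_neighbours:
  assumes "distinct xs" "3 \<le> length xs" "w \<in> set xs"
  obtains a b where "a \<noteq> b" "a \<in> set xs" "b \<in> set xs" "{z. (w, z) \<in> ring_arcs xs} = {a, b}"
proof -
  obtain as bs where xs: "xs = as @ w # bs" using assms(3) by (auto simp: in_set_conv_decomp)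
  define ys where "ys = bs @ as"
  have R: "ring_arcs xs = ring_arcs (w # ys)"
    using ring_arcs_rotate[of as "w # bs"] by (cases "as = []") (auto simp: xs ys_def)
  have d: "distinct ys" "w \<notin> set ys" "2 \<le> length ys" "set ys \<subseteq> set xs"
    using assms by (auto simp: xs ys_def)
  have "\<exists>a zs. ys = a # zs \<and> zs \<noteq> []" using d(3) by (cases ys) auto
  then obtain a zs where ys: "ys = a # zs" "zs \<noteq> []" by blast
  have "last zs \<in> set zs" using ys by auto
  then have "a \<noteq> last zs" "last zs \<in> set xs"
    using d ys by (metis distinct.simps(2), metis list.set_intros(2) subsetD)
  moreover have "{z. (w, z) \<in> ring_arcs xs} = {a, last zs}"
    using d ys set_vwalk_arcs_subset[of ys] by (auto simp: R ring_arcs_conv Let_def)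
  ultimately show thesis using that[of a "last zs"] d ys by auto
qed

text \<open>Ensures that every ring found in \<open>F\<close> is counted by its excess.\<close>

lemma ring_arcs_in_edge_cycles:
  assumes "pair_graph F" "distinct xs" "3 \<le> length xs" "ring_arcs xs \<subseteq> parcs F"
  shows "ring_arcs xs \<in> edge_cycles F"
proof -
  interpret pair_graph F by fact
  have ne: "xs \<noteq> []" using assms by auto
  let ?ys = "xs @ [hd xs]"
  have arcs: "set (vwalk_arcs ?ys) \<subseteq> parcs F" using assms by (auto simp: ring_arcs_def)
  have "set xs \<subseteq> pverts F"
  proof
    fix w assume "w \<in> set xs"
    then obtain a where "(w, a) \<in> ring_arcs xs"
      by (rule ring_arcs_neighbours[OF assms(2,3)]) blast
    then show "w \<in> pverts F" using assms(4) in_arcsD1 by auto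
  qed
  then have "vwalk ?ys F" using arcs ne by (intro vwalkI) auto
  from awalk_vwalk_arcs[OF this] have "awalk (hd xs) (vwalk_arcs ?ys) (hd xs)" using ne by simp
  moreover have "pawalk_verts (hd xs) (vwalk_arcs ?ys) = ?ys"
    using pawalk_verts_vwalk_arcs[of ?ys] ne by simp
  then have "distinct (tl (pawalk_verts (hd xs) (vwalk_arcs ?ys)))"
    using assms(2) ne by (cases xs) auto
  moreover have len: "length (vwalk_arcs ?ys) = length xs" by (simp add: length_vwalk_arcs)
  moreover have "vwalk_arcs ?ys \<noteq> []" using len ne by (metis length_0_conv)
  ultimately have "cycle (vwalk_arcs ?ys)" unfolding cycle_def by blast
  then show ?thesis unfolding edge_cycles_def ring_arcs_def using assms(3) len by auto
qed

text \<open>Its members are sets of arcs of \<open>F\<close>. Finiteness makes \<open>card\<close>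
  monotone here, since \<open>card\<close> of an infinite set is 0.\<close>

lemma finite_edge_cycles:
  assumes "pair_graph F"
  shows "finite (edge_cycles F)"
proof -
  interpret pair_graph F by fact
  have "edge_cycles F \<subseteq> Pow (parcs F)"
    using arcs_symmetric by (auto simp: edge_cycles_def cycle_def awalk_def)
  then show ?thesis using pair_finite_arcs by (simp add: finite_subset)
qed

section \<open>Graphs with all degrees 0 or 2\<close>

lemma out_degree_conv_card: "out_degree (with_proj F) w = card {z. (w, z) \<in> parcs F}"
proof -
  have "out_arcs (with_proj F) w = Pair w ` {z. (w, z) \<in> parcs F}"
    by (auto simp: out_arcs_def)
  then show ?thesis by (simp add: out_degree_def card_image inj_on_def)
qed

text \<open>Captures the part of \<open>even_cover\<close> that concerns the cover alone, without
  its host graph.\<close>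

locale even_graph = pair_graph G for G :: "'a pair_pre_digraph" +
  assumes even_degree: "w \<in> pverts G \<Longrightarrow> out_degree (with_proj G) w \<in> {0, 2}"
begin

lemma neighbours_doubleton:
  assumes "(w, a) \<in> parcs G"
  obtains b where "b \<noteq> a" "{z. (w, z) \<in> parcs G} = {a, b}"
proof -
  have "{z. (w, z) \<in> parcs G} \<subseteq> pverts G" using in_arcsD2 by auto
  \<comment> \<open>Finiteness lets \<open>card\<close> 0 mean an empty neighbourhood, which the
    neighbour \<open>a\<close> excludes.\<close>
  then have fin: "finite {z. (w, z) \<in> parcs G}" using pair_finite_verts finite_subset by blast
  have "card {z. (w, z) \<in> parcs G} \<in> {0, 2}"
    using even_degree[OF in_arcsD1[OF assms]] by (simp add: out_degree_conv_card)
  then have "card {z. (w, z) \<in> parcs G} = 2" using assms fin by auto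
  then obtain b c where bc: "{z. (w, z) \<in> parcs G} = {b, c}" "b \<noteq> c" by (auto simp: card_2_iff)
  then have "a = b \<or> a = c" using assms by blast
  then show thesis using that[of b] that[of c] bc by (auto simp: insert_commute)
qed

text \<open>The other neighbour of the last vertex of a longest path starting with the given arc lies on
  the path, and since the inner vertices have no third neighbour it is the first vertex.\<close>

lemma obtain_ring:
  assumes "(y, z) \<in> parcs G"
  obtains zs where "distinct (y # z # zs)" "zs \<noteq> []" "ring_arcs (y # z # zs) \<subseteq> parcs G"
proof -
  define P where "P zs \<longleftrightarrow> distinct (y # z # zs) \<and> set (vwalk_arcs (y # z # zs)) \<subseteq> parcs G" for zs
  have bound: "length zs < Suc (card (pverts G))" if "P zs" for zs
  proof -
    have "set (y # z # zs) \<subseteq> pverts G"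
    proof -
      \<comment> \<open>Every vertex after the first is the head of an arc of the list.\<close>
      have "set xs \<subseteq> insert (hd xs) (snd ` set (vwalk_arcs xs))" for xs :: "'a list"
        by (induct xs rule: vwalk_arcs.induct) auto
      from this[of "y # z # zs"]
      have "set (y # z # zs) \<subseteq> insert y (snd ` set (vwalk_arcs (y # z # zs)))" by simp
      moreover have "snd ` set (vwalk_arcs (y # z # zs)) \<subseteq> pverts G"
        using that arc_snd_in_verts unfolding P_def by blast
      ultimately show ?thesis using in_arcsD1[OF assms] by blast
    qed
    then have "card (set (y # z # zs)) \<le> card (pverts G)"
      using pair_finite_verts by (rule card_mono[rotated])
    moreover have "card (set (y # z # zs)) = length (y # z # zs)"
      using that unfolding P_def by (intro distinct_card) auto
    ultimately show ?thesis by simp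
  qed
  have "P []" using assms no_loops' by (auto simp: P_def)
  then obtain zs where zs: "P zs" and max: "\<And>zs'. P zs' \<Longrightarrow> length zs' \<le> length zs"
    using ex_has_greatest_nat[of P "[]" length "Suc (card (pverts G))"] bound by blast
  define xs where "xs = y # z # zs"
  obtain ps w' w where xs: "xs = ps @ [w', w]"
    by (cases xs rule: rev_cases; cases "butlast xs" rule: rev_cases) (auto simp: xs_def)
  have arcs: "set (vwalk_arcs xs) \<subseteq> parcs G" and dist: "distinct xs"
    using zs by (auto simp: P_def xs_def)
  have "(w', w) \<in> parcs G"
    using arcs unfolding xs by (cases "ps = []") (auto simp: vwalk_arcs_append)
  then obtain x where x: "x \<noteq> w'" "(w, x) \<in> parcs G"
    using neighbours_doubleton[OF arcs_symmetric] by blast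
  have "x \<in> set xs"
  proof (rule ccontr)
    assume "x \<notin> set xs"
    moreover have "set (vwalk_arcs (xs @ [x])) \<subseteq> parcs G"
      using arcs x by (subst set_vwalk_arcs_snoc) (auto simp: xs)
    ultimately have "P (zs @ [x])" using dist by (auto simp: P_def xs_def)
    then show False using max by fastforce
  qed
  moreover have "x \<noteq> w" using x no_loops' by auto
  ultimately have "x \<in> set ps" using x by (auto simp: xs)
  then obtain qs rs where ps: "ps = qs @ x # rs" by (auto simp: in_set_conv_decomp)
  have "qs = []"
  proof (rule ccontr)
    assume qs: "qs \<noteq> []"
    \<comment> \<open>The successor of \<open>x\<close> on the path, which is \<open>w'\<close> when
      \<open>rs\<close> is empty. With \<open>last qs\<close> and \<open>w\<close> it gives
      \<open>x\<close> three distinct neighbours.\<close>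
    define b where "b = hd (rs @ [w'])"
    have xs': "xs = qs @ (x # rs @ [w']) @ [w]" by (simp add: xs ps)
    have "(last qs, x) \<in> parcs G"
      using arcs qs unfolding xs' by (subst (asm) vwalk_arcs_append) auto
    moreover have "(x, b) \<in> parcs G"
      using arcs qs unfolding xs' b_def by (cases rs) (simp_all add: vwalk_arcs_append)
    moreover have "(w, x) \<in> parcs G" by fact
    ultimately have N: "(x, last qs) \<in> parcs G" "(x, b) \<in> parcs G" "(x, w) \<in> parcs G"
      using arcs_symmetric by auto
    have "b \<in> set (rs @ [w'])" unfolding b_def by (rule hd_in_set) simp
    then have ne: "last qs \<noteq> b" "last qs \<noteq> w" "b \<noteq> w"
      using dist last_in_set[OF qs] unfolding xs' by auto
    obtain c where "{z. (x, z) \<in> parcs G} = {last qs, c}" using neighbours_doubleton[OF N(1)] .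
    then have "b \<in> {last qs, c}" "w \<in> {last qs, c}" using N by blast+
    then show False using ne by auto
  qed
  then have y: "x = y" using ps xs xs_def by auto
  \<comment> \<open>\<open>ps\<close> contains \<open>x\<close>, so the path has at least three
    vertices.\<close>
  have "zs \<noteq> []" using \<open>x \<in> set ps\<close> xs x y \<open>x \<noteq> w\<close> by (cases ps) (auto simp: xs_def)
  moreover have "ring_arcs xs \<subseteq> parcs G"
  proof (rule ring_arcs_subset_parcs[OF pair_graph _ arcs])
    have "hd xs = y" by (simp add: xs_def)
    moreover have "last xs = w" by (simp add: xs)
    ultimately show "(last xs, hd xs) \<in> parcs G" using x y by simp
  qed (simp add: xs_def)
  ultimately show thesis using that dist by (auto simp: xs_def)
qed

text \<open>The ring already provides both neighbours that the degree allows, so it is a whole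
  component.\<close>

lemma ring_closed:
  assumes "distinct xs" "3 \<le> length xs" "ring_arcs xs \<subseteq> parcs G" "w \<in> set xs" "(w, z) \<in> parcs G"
  shows "z \<in> set xs"
proof -
  obtain a b where ab: "a \<noteq> b" "a \<in> set xs" "b \<in> set xs" "{z. (w, z) \<in> ring_arcs xs} = {a, b}"
    using ring_arcs_neighbours[OF assms(1,2,4)] .
  then have "(w, a) \<in> parcs G" "(w, b) \<in> parcs G" using assms(3) by blast+
  then have "{z. (w, z) \<in> parcs G} = {a, b}"
    using neighbours_doubleton[of w a] ab(1) by (metis (mono_tags) insertE mem_Collect_eq singletonD)
  then show ?thesis using assms(5) ab by auto
qed

end

text \<open>One ring with all remaining vertices isolated: degree 2 on the ring, 0
  elsewhere.\<close>

lemma ring_even_cover: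
  assumes "pair_graph G" "distinct xs" "3 \<le> length xs" "ring_arcs xs \<subseteq> parcs G"
  shows "even_cover G \<lparr>pverts = pverts G, parcs = ring_arcs xs\<rparr>" (is "even_cover G ?F")
proof -
  interpret pair_graph G by fact
  interpret F: pair_graph ?F
  proof
    show "symmetric (with_proj ?F)" using sym_ring_arcs by (auto simp: symmetric_def)
    show "finite (parcs ?F)" using finite_subset[OF assms(4) pair_finite_arcs] by simp
  qed (use assms(4) in_arcsD1 in_arcsD2 pair_finite_verts no_loops' in auto)
  have "card {z. (w, z) \<in> ring_arcs xs} \<in> {0, 2}" for w
  proof (cases "w \<in> set xs")
    case True
    then show ?thesis by (rule ring_arcs_neighbours[OF assms(2,3)]) simp
  next
    case False
    moreover have "xs \<noteq> []" using assms(3) by auto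
    ultimately have "{z. (w, z) \<in> ring_arcs xs} = {}" using ring_arcs_subset[of xs] by auto
    then show ?thesis by simp
  qed
  moreover have "spanning (with_proj ?F) (with_proj G)"
    using assms(4) by (auto simp: spanning_def subgraph_def compatible_def wf_digraph F.wf_digraph)
  ultimately show ?thesis
    using F.pair_graph by (auto simp: even_cover_def out_degree_conv_card)
qed

section \<open>Covering walks from even covers\<close>

lemma pair_graph_del_edge:
  assumes "pair_graph G"
  shows "pair_graph (del_edge G u v)"
proof -
  interpret pair_graph G by fact
  show ?thesis
  proof
    show "symmetric (with_proj (del_edge G u v))"
      using arcs_symmetric by (auto simp: symmetric_def sym_def del_edge_def)
  qed (auto simp: del_edge_def arc_fst_in_verts arc_snd_in_verts pair_finite_verts pair_finite_arcs
      dest: pair_no_loops no_loops' intro: in_arcsD1 in_arcsD2)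
qed

text \<open>By symmetry \<open>y\<close> is reachable from \<open>x\<close>, and a walk between them
  has to leave \<open>S\<close> at some arc.\<close>

lemma connected_crossing_arc:
  assumes "pair_graph H" "connected (with_proj H)"
    and "x \<in> S" "x \<in> pverts H" "y \<in> pverts H" "y \<notin> S"
  obtains a b where "a \<in> S" "b \<notin> S" "(a, b) \<in> parcs H"
proof -
  interpret pair_graph H by fact
  have "strongly_connected (with_proj H)"
    using symmetric_connected_imp_strongly_connected sym_arcs assms(2) by blast
  then have "x \<rightarrow>\<^sup>*\<^bsub>with_proj H\<^esub> y" using assms by (auto simp: strongly_connected_def)
  then have "\<exists>a b. a \<in> S \<and> b \<notin> S \<and> (a, b) \<in> parcs H" using assms(6)
    by (induct rule: reachable_induct) (use assms(3) in auto)
  then show thesis using that by blast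
qed

section \<open>Excess confined to a vertex set\<close>

text \<open>The share of the excess due to components inside \<open>S\<close>: the budget of a walk
  with vertex set \<open>S\<close>.\<close>

definition exc_on :: "'a pair_pre_digraph \<Rightarrow> 'a set \<Rightarrow> nat" where
  "exc_on F S = 2 * card {c \<in> edge_cycles F. c \<subseteq> S \<times> S} + card (isolated_verts F \<inter> S)"

lemma exc_on_le:
  assumes "pair_graph F"
  shows "exc_on F S \<le> exc F"
proof -
  interpret pair_graph F by fact
  have "finite (isolated_verts F)" using pair_finite_verts by (simp add: isolated_verts_def)
  then show ?thesis unfolding exc_on_def exc_def
    using finite_edge_cycles[OF assms] by (intro add_mono mult_left_mono card_mono) auto
qed

lemma exc_on_Un_ring:
  assumes "pair_graph F" "distinct xs" "3 \<le> length xs" "ring_arcs xs \<subseteq> parcs F" "S \<inter> set xs = {}"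
  shows "exc_on F S + 2 \<le> exc_on F (S \<union> set xs)"
proof -
  interpret pair_graph F by fact
  have fin: "finite (edge_cycles F)" "finite (isolated_verts F)"
    using finite_edge_cycles[OF assms(1)] pair_finite_verts by (simp_all add: isolated_verts_def)
  let ?C = "\<lambda>S. {c \<in> edge_cycles F. c \<subseteq> S \<times> S}"
  have ne: "xs \<noteq> []" using assms(3) by auto
  \<comment> \<open>An arc with an endpoint outside \<open>S\<close> shows that the ring is not yet
    counted; as a cycle it then adds 2.\<close>
  then have "(last xs, hd xs) \<in> ring_arcs xs" by (simp add: ring_arcs_conv Let_def)
  moreover have "hd xs \<notin> S" using hd_in_set[OF ne] assms(5) by blast
  ultimately have new: "ring_arcs xs \<notin> ?C S" by blast
  have "insert (ring_arcs xs) (?C S) \<subseteq> ?C (S \<union> set xs)"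
    using ring_arcs_in_edge_cycles[OF assms(1-4)] ring_arcs_subset[OF ne] by auto
  then have "card (insert (ring_arcs xs) (?C S)) \<le> card (?C (S \<union> set xs))"
    using fin by (intro card_mono) auto
  then have "Suc (card (?C S)) \<le> card (?C (S \<union> set xs))" using new fin by simp
  moreover have "card (isolated_verts F \<inter> S) \<le> card (isolated_verts F \<inter> (S \<union> set xs))"
    using fin by (intro card_mono) auto
  ultimately show ?thesis unfolding exc_on_def by linarith
qed

lemma exc_on_insert_isolated:
  assumes "pair_graph F" "y \<in> isolated_verts F" "y \<notin> S"
  shows "exc_on F S + 1 \<le> exc_on F (insert y S)"
proof -
  interpret pair_graph F by fact
  have fin: "finite (edge_cycles F)" "finite (isolated_verts F)"
    using finite_edge_cycles[OF assms(1)] pair_finite_verts by (simp_all add: isolated_verts_def)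
  have "card {c \<in> edge_cycles F. c \<subseteq> S \<times> S} \<le> card {c \<in> edge_cycles F. c \<subseteq> insert y S \<times> insert y S}"
    using fin by (intro card_mono) auto
  moreover have "card (isolated_verts F \<inter> insert y S) = Suc (card (isolated_verts F \<inter> S))"
    using fin assms(2,3) by simp
  ultimately show ?thesis unfolding exc_on_def by linarith
qed

section \<open>Growing a frugal walk by detours\<close>

text \<open>The invariant of the extension argument. \<open>length xs\<close> counts vertices, one
  more than arcs, so the 2 here is the 3 of the bound on the walk length.\<close>

definition frugal_walk ::
  "'a pair_pre_digraph \<Rightarrow> 'a pair_pre_digraph \<Rightarrow> 'a \<Rightarrow> 'a \<Rightarrow> 'a list \<Rightarrow> bool" where
  "frugal_walk H F u v xs \<longleftrightarrow> vwalk xs (with_proj H) \<and> hd xs = u \<and> last xs = v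
     \<and> (\<forall>(x, y) \<in> parcs F. x \<in> set xs \<longrightarrow> y \<in> set xs)
     \<and> length xs + 2 \<le> card (set xs) + exc_on F (set xs)"

text \<open>Besides \<open>ys\<close>, the vertex \<open>x\<close> is written a second time, so the
  list grows by \<open>length ys + 1\<close>; the last hypothesis pays for this.\<close>

lemma frugal_walk_detour:
  assumes "frugal_walk H F u v xs" "pair_graph H"
    and "x \<in> set xs" "vwalk ys (with_proj H)" "set xs \<inter> set ys = {}"
    and "(x, hd ys) \<in> parcs H" "(last ys, x) \<in> parcs H"
    and "\<forall>(a, b) \<in> parcs F. a \<in> set ys \<longrightarrow> b \<in> set ys"
    and "exc_on F (set xs) + length ys + 1 \<le> exc_on F (set xs \<union> set ys) + card (set ys)"
  obtains xs' where "frugal_walk H F u v xs'" "set xs' = set xs \<union> set ys"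
proof -
  obtain as bs where xs: "xs = as @ x # bs" using assms(3) by (auto simp: in_set_conv_decomp)
  let ?xs = "as @ x # ys @ x # bs"
  have s: "set ?xs = set xs \<union> set ys" by (auto simp: xs)
  have "vwalk ?xs (with_proj H)"
    using vwalk_insert_detour assms(1,4,6,7) unfolding frugal_walk_def xs by metis
  moreover have "hd ?xs = hd xs" "last ?xs = last xs" by (cases as; simp add: xs)+
  moreover have "card (set ?xs) = card (set xs) + card (set ys)"
    unfolding s by (rule card_Un_disjoint) (use assms(5) in auto)
  moreover have "length ?xs = length xs + length ys + 1" by (simp add: xs)
  ultimately have "frugal_walk H F u v ?xs"
    using assms(1,8,9) unfolding frugal_walk_def s by auto
  then show thesis using that s by blast
qed

lemma frugal_walk_extend:
  assumes "pair_graph H" "connected (with_proj H)" "even_graph F" "pverts F = pverts H"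
    and "u \<noteq> v" "parcs F - {(u, v), (v, u)} \<subseteq> parcs H"
    and "frugal_walk H F u v xs" "\<not> pverts H \<subseteq> set xs"
  obtains xs' where "frugal_walk H F u v xs'" "set xs \<subset> set xs'"
proof -
  interpret H: pair_graph H by fact
  interpret F: even_graph F by fact
  have walk: "vwalk xs (with_proj H)" "hd xs = u" "last xs = v"
    and closed: "\<And>a b. (a, b) \<in> parcs F \<Longrightarrow> a \<in> set xs \<Longrightarrow> b \<in> set xs"
    using assms(7) by (auto simp: frugal_walk_def)
  have uv: "u \<in> set xs" "v \<in> set xs" "set xs \<subseteq> pverts H" using walk by (auto simp: vwalk_def)
  obtain w where "w \<in> pverts H" "w \<notin> set xs" using assms(8) by auto
  then obtain x y where xy: "x \<in> set xs" "y \<notin> set xs" "(x, y) \<in> parcs H"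
    using connected_crossing_arc[OF assms(1,2) uv(1)] uv by blast
  have yx: "(y, x) \<in> parcs H" using xy(3) H.arcs_symmetric by auto
  have yV: "y \<in> pverts H" using xy(3) H.in_arcsD2 by auto
  show thesis
  proof (cases "\<exists>z. (y, z) \<in> parcs F")
    case True
    then obtain z zs where zs: "distinct (y # z # zs)" "zs \<noteq> []" "ring_arcs (y # z # zs) \<subseteq> parcs F"
      using F.obtain_ring by blast
    define cs where "cs = y # z # zs"
    \<comment> \<open>The detour goes once around and ends at \<open>y\<close> again, from where the
      arc back to \<open>x\<close> is available.\<close>
    let ?ys = "cs @ [y]"
    have cs: "distinct cs" "3 \<le> length cs" "ring_arcs cs \<subseteq> parcs F" "y \<in> set cs"
      using zs by (auto simp: cs_def Suc_le_eq)
    note closed' = F.ring_closed[OF cs(1-3)]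
    have disj: "set xs \<inter> set cs = {}"
    proof -
      have "a \<in> set xs" if "(a, b) \<in> parcs F" "b \<in> set xs" for a b
        using closed F.arcs_symmetric that by blast
      \<comment> \<open>By symmetry no arc of \<open>F\<close> enters \<open>set xs\<close> from
        outside, so following the ring from \<open>y\<close> never meets the walk.\<close>
      then have "set (vwalk_arcs ps) \<subseteq> parcs F \<Longrightarrow> ps \<noteq> [] \<Longrightarrow> hd ps \<notin> set xs
          \<Longrightarrow> set xs \<inter> set ps = {}" for ps
        by (induct ps rule: vwalk_arcs.induct) auto
      from this[of cs] show ?thesis using cs xy(2) by (auto simp: cs_def ring_arcs_conv Let_def)
    qed
    have sub: "set cs \<subseteq> pverts H"
    proof
      fix w assume "w \<in> set cs"
      then obtain a where "(w, a) \<in> ring_arcs cs"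
        by (rule ring_arcs_neighbours[OF cs(1,2)]) blast
      then show "w \<in> pverts H" using cs(3) F.in_arcsD1 assms(4) by auto
    qed
    have "set (vwalk_arcs ?ys) \<subseteq> ring_arcs cs" by (auto simp: ring_arcs_def cs_def)
    \<comment> \<open>Both \<open>u\<close> and \<open>v\<close> lie on the walk, so a ring disjoint
      from it avoids the deleted edge and survives in \<open>H\<close>.\<close>
    moreover have "ring_arcs cs \<inter> {(u, v), (v, u)} = {}"
      using ring_arcs_subset[of cs] disj uv by (auto simp: cs_def)
    ultimately have "set (vwalk_arcs ?ys) \<subseteq> parcs H" using cs(3) assms(6) by blast
    then have "vwalk ?ys (with_proj H)" using sub cs by (intro vwalkI) auto
    moreover have s: "set ?ys = set cs" using cs by auto
    \<comment> \<open>The list grows by \<open>length cs + 2\<close>: the new vertices pay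
      \<open>length cs\<close>, the new cycle pays 2.\<close>
    moreover have "exc_on F (set xs) + length ?ys + 1 \<le> exc_on F (set xs \<union> set cs) + card (set cs)"
      using exc_on_Un_ring[OF F.pair_graph cs(1-3) disj] distinct_card[OF cs(1)] by simp
    moreover have "hd ?ys = y" "last ?ys = y" by (simp_all add: cs_def)
    moreover have "\<forall>(a, b) \<in> parcs F. a \<in> set cs \<longrightarrow> b \<in> set cs" using closed' by blast
    ultimately obtain xs' where "frugal_walk H F u v xs'" "set xs' = set xs \<union> set cs"
      using frugal_walk_detour[OF assms(7,1) xy(1), of ?ys] disj xy(3) yx unfolding s by metis
    then show thesis using that xy(2) cs(4) by blast
  next
    case False
    then have iso: "y \<in> isolated_verts F"
      using yV assms(4) by (simp add: isolated_verts_def out_degree_conv_card)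
    have "vwalk [y] (with_proj H)" using yV by simp
    moreover have "exc_on F (set xs) + length [y] + 1 \<le> exc_on F (set xs \<union> set [y]) + card (set [y])"
      using exc_on_insert_isolated[OF F.pair_graph iso xy(2)] by simp
    ultimately obtain xs' where "frugal_walk H F u v xs'" "set xs' = set xs \<union> set [y]"
      using frugal_walk_detour[OF assms(7,1) xy(1), of "[y]"] xy yx False by auto
    then show thesis using that xy(2) by auto
  qed
qed

text \<open>A frugal walk with the most distinct vertices, a number bounded by the order of
  \<open>H\<close>, misses none, as otherwise it could be extended.\<close>

lemma frugal_walk_spanning:
  assumes "pair_graph H" "connected (with_proj H)" "even_graph F" "pverts F = pverts H"
    and "u \<noteq> v" "parcs F - {(u, v), (v, u)} \<subseteq> parcs H"
    and "frugal_walk H F u v xs"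
  obtains xs' where "frugal_walk H F u v xs'" "pverts H \<subseteq> set xs'"
proof -
  interpret H: pair_graph H by fact
  have bound: "card (set ys) \<le> card (pverts H)" if "frugal_walk H F u v ys" for ys
    using that H.pair_finite_verts by (auto simp: frugal_walk_def vwalk_def intro: card_mono)
  obtain ys where ys: "frugal_walk H F u v ys"
    and max: "\<And>zs. frugal_walk H F u v zs \<Longrightarrow> card (set zs) \<le> card (set ys)"
    using ex_has_greatest_nat[of "frugal_walk H F u v" xs "\<lambda>ys. card (set ys)" "Suc (card (pverts H))"]
      assms(7) bound by (metis le_imp_less_Suc less_imp_le)
  have "pverts H \<subseteq> set ys"
  proof (rule ccontr)
    assume "\<not> pverts H \<subseteq> set ys"
    then obtain zs where "frugal_walk H F u v zs" "set ys \<subset> set zs"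
      using frugal_walk_extend[OF assms(1-6) ys] by blast
    then show False using max psubset_card_mono[of "set zs" "set ys"] by fastforce
  qed
  then show thesis using that ys by blast
qed

text \<open>The ring through \<open>uv\<close>, cut at that edge, is a path: its list length equals
  its number of vertices, and the ring itself pays the constant 2.\<close>

lemma frugal_walk_init:
  assumes "even_graph F" "(u, v) \<in> parcs F" "pverts F = pverts H"
    and "parcs F - {(u, v), (v, u)} \<subseteq> parcs H"
  obtains xs where "frugal_walk H F u v xs"
proof -
  interpret F: even_graph F by fact
  have "(v, u) \<in> parcs F" using assms(2) F.arcs_symmetric by auto
  \<comment> \<open>The ring begins with the arc \<open>(v, u)\<close>, so moving \<open>v\<close>
    to the end drops exactly this edge.\<close>
  then obtain zs where zs: "distinct (v # u # zs)" "zs \<noteq> []" "ring_arcs (v # u # zs) \<subseteq> parcs F"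
    using F.obtain_ring by blast
  define cs where "cs = v # u # zs"
  let ?xs = "u # zs @ [v]"
  have cs: "distinct cs" "3 \<le> length cs" "ring_arcs cs \<subseteq> parcs F"
    using zs by (auto simp: cs_def Suc_le_eq)
  have s: "set ?xs = set cs" by (auto simp: cs_def)
  have arcs: "set (vwalk_arcs ?xs) = insert (last zs, v) (set (vwalk_arcs (u # zs)))"
    using set_vwalk_arcs_snoc[of "u # zs" v] zs(2) by simp
  have "set (vwalk_arcs ?xs) \<subseteq> parcs F"
    using zs(2,3) unfolding arcs by (auto simp: ring_arcs_conv Let_def)
  moreover have "set (vwalk_arcs ?xs) \<inter> {(u, v), (v, u)} = {}"
    \<comment> \<open>The arcs of \<open>u # zs\<close> avoid \<open>v\<close>, and the final arc
      starts at \<open>last zs\<close>, which is not \<open>u\<close>.\<close>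
    using zs(1) last_in_set[OF zs(2)] set_vwalk_arcs_subset[of "u # zs"] unfolding arcs by auto
  ultimately have A: "set (vwalk_arcs ?xs) \<subseteq> parcs F" "set (vwalk_arcs ?xs) \<subseteq> parcs H"
    using assms(4) by blast+
  have "set ?xs \<subseteq> pverts H"
  proof
    fix w assume "w \<in> set ?xs"
    then obtain a where "(w, a) \<in> ring_arcs cs"
      unfolding s by (rule ring_arcs_neighbours[OF cs(1,2)]) blast
    then show "w \<in> pverts H" using cs(3) F.in_arcsD1 assms(3) by auto
  qed
  then have "vwalk ?xs (with_proj H)" using A by (intro vwalkI) auto
  moreover have "length ?xs + 2 \<le> card (set ?xs) + exc_on F (set ?xs)"
    using exc_on_Un_ring[OF F.pair_graph cs, of "{}"] distinct_card[OF cs(1)]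
    unfolding s by (simp add: cs_def)
  ultimately have "frugal_walk H F u v ?xs"
    using F.ring_closed[OF cs] s unfolding frugal_walk_def by auto
  then show thesis using that by blast
qed

lemma even_cover_imp_covering_walk:
  assumes "pair_graph G" "connected (with_proj (del_edge G u v))" "F \<in> even_covers_through G u v"
  obtains p where "covering_walk (del_edge G u v) u p v" "length p + 3 \<le> card (pverts G) + exc F"
proof -
  let ?H = "del_edge G u v"
  interpret H: pair_graph ?H using assms(1) by (rule pair_graph_del_edge)
  have F: "even_graph F" "(u, v) \<in> parcs F" and sp: "spanning (with_proj F) (with_proj G)"
    using assms(3) by (auto simp: even_covers_through_def even_cover_def even_graph_def
        even_graph_axioms_def)
  interpret F: even_graph F by fact
  have V: "pverts F = pverts ?H" and A: "parcs F - {(u, v), (v, u)} \<subseteq> parcs ?H"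
    using sp by (auto simp: spanning_def subgraph_def del_edge_def)
  have ne: "u \<noteq> v" using F.no_loops'[OF F(2)] .
  obtain ys where "frugal_walk ?H F u v ys"
    using frugal_walk_init[OF F V A] .
  then obtain xs where xs: "frugal_walk ?H F u v xs" "pverts ?H \<subseteq> set xs"
    using frugal_walk_spanning[OF H.pair_graph assms(2) F(1) V ne A] by blast
  then have walk: "vwalk xs (with_proj ?H)" "hd xs = u" "last xs = v"
    and len: "length xs + 2 \<le> card (set xs) + exc_on F (set xs)"
    by (auto simp: frugal_walk_def)
  have nil: "xs \<noteq> []" and s: "set xs = pverts G"
    using walk(1) xs(2) by (auto simp: del_edge_def)
  have "covering_walk ?H u (vwalk_arcs xs) v"
    using H.awalk_vwalk_arcs[OF walk(1)] walk xs(2) pawalk_verts_vwalk_arcs[OF nil]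
    by (auto simp: covering_walk_def)
  \<comment> \<open>A nonempty list has one arc fewer than vertices, which turns 2 into 3.\<close>
  moreover have "length (vwalk_arcs xs) + 3 \<le> card (pverts G) + exc F"
    using len exc_on_le[OF F.pair_graph, of "set xs"] nil s
    by (cases xs) (auto simp: length_vwalk_arcs)
  ultimately show thesis using that by blast
qed

section \<open>Existence of an even cover through a given edge\<close>

text \<open>A path from \<open>u\<close> to \<open>v\<close> avoiding the edge closes up with it to
  a ring. Hence \<open>Min\<close> in \<open>exc_edge\<close> is taken over a nonempty set.\<close>

lemma even_covers_through_nonempty:
  assumes "pair_graph G" "(u, v) \<in> parcs G" "connected (with_proj (del_edge G u v))"
  shows "even_covers_through G u v \<noteq> {}"
proof -
  let ?H = "del_edge G u v"
  interpret G: pair_graph G by fact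
  interpret H: pair_graph ?H using assms(1) by (rule pair_graph_del_edge)
  have ne: "u \<noteq> v" using G.no_loops' assms(2) by auto
  have "u \<in> pverts ?H" "v \<in> pverts ?H"
    using assms(2) G.in_arcsD1 G.in_arcsD2 by (auto simp: del_edge_def)
  moreover have "strongly_connected (with_proj ?H)"
    using H.symmetric_connected_imp_strongly_connected H.sym_arcs assms(3) by blast
  ultimately have "u \<rightarrow>\<^sup>*\<^bsub>with_proj ?H\<^esub> v" by (auto simp: strongly_connected_def)
  then obtain p where "H.apath u p v" using H.reachable_apath by auto
  then have p: "H.awalk u p v" "distinct (pawalk_verts u p)" by (auto simp: H.apath_def)
  define xs where "xs = pawalk_verts u p"
  have xs: "vwalk xs (with_proj ?H)" "distinct xs" "hd xs = u" "last xs = v"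
    using H.awalk_imp_vwalk[OF p(1)] p by (auto simp: xs_def)
  have nil: "xs \<noteq> []" using xs by auto
  have arcs: "set (vwalk_arcs xs) \<subseteq> parcs ?H" using xs(1) by (simp add: vwalk_def)
  \<comment> \<open>One vertex would give \<open>u = v\<close>, and two would use the deleted arc
    \<open>(u, v)\<close>.\<close>
  have "3 \<le> length xs"
  proof (rule ccontr)
    assume "\<not> 3 \<le> length xs"
    then have "length xs = 0 \<or> length xs = 1 \<or> length xs = 2" by linarith
    then show False
      using nil xs ne arcs by (auto simp: length_Suc_conv numeral_2_eq_2 del_edge_def)
  qed
  moreover have "ring_arcs xs \<subseteq> parcs G"
    using arcs assms(2) G.arcs_symmetric xs nil
    by (intro ring_arcs_subset_parcs[OF assms(1)]) (auto simp: del_edge_def)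
  ultimately have "even_cover G \<lparr>pverts = pverts G, parcs = ring_arcs xs\<rparr>"
    using ring_even_cover[OF assms(1) xs(2)] by blast
  moreover have "(u, v) \<in> ring_arcs xs" using xs nil by (auto simp: ring_arcs_conv Let_def)
  ultimately show ?thesis by (auto simp: even_covers_through_def)
qed

text \<open>Spanning fixes the vertex set, so a cover is determined by a subset of the finite set
  \<open>parcs G\<close>.\<close>

lemma finite_even_covers_through:
  assumes "pair_graph G"
  shows "finite (even_covers_through G u v)"
proof -
  interpret pair_graph G by fact
  have "F \<in> (\<lambda>A. \<lparr>pverts = pverts G, parcs = A\<rparr>) ` Pow (parcs G)"
    if "F \<in> even_covers_through G u v" for F
    using that by (cases F) (auto simp: even_covers_through_def even_cover_def spanning_def subgraph_def)
  then have "even_covers_through G u v \<subseteq> (\<lambda>A. \<lparr>pverts = pverts G, parcs = A\<rparr>) ` Pow (parcs G)"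
    by blast
  then show ?thesis using pair_finite_arcs by (simp add: finite_subset)
qed

theorem lemma7:
  fixes G :: "'a pair_pre_digraph" and u v :: 'a
  assumes "pair_graph G"
    and "subcubic G"
    and "(u, v) \<in> parcs G"
    and "connected (del_edge G u v)"
  shows "(\<forall>F \<in> even_covers_through G u v.
            \<exists>p. covering_walk (del_edge G u v) u p v
              \<and> int (length p) \<le> int (card (pverts G)) + int (exc F) - 3)
       \<and> int (OPT (del_edge G u v) u v) \<le> int (card (pverts G)) + exc_edge G u v - 1"
proof -
  have walk: "\<exists>p. covering_walk (del_edge G u v) u p v
      \<and> int (length p) \<le> int (card (pverts G)) + int (exc F) - 3"
    if F: "F \<in> even_covers_through G u v" for F
  proof -
    obtain p where "covering_walk (del_edge G u v) u p v" "length p + 3 \<le> card (pverts G) + exc F"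
      using even_cover_imp_covering_walk[OF assms(1,4) F] .
    then show ?thesis by (intro exI[of _ p]) linarith
  qed
  have "Min (exc ` even_covers_through G u v) \<in> exc ` even_covers_through G u v"
    using even_covers_through_nonempty[OF assms(1,3,4)] finite_even_covers_through[OF assms(1)]
    by (intro Min_in) auto
  then obtain F where F: "F \<in> even_covers_through G u v"
    and min: "Min (exc ` even_covers_through G u v) = exc F" by auto
  obtain p where p: "covering_walk (del_edge G u v) u p v"
    "int (length p) \<le> int (card (pverts G)) + int (exc F) - 3" using walk[OF F] by blast
  have "OPT (del_edge G u v) u v \<le> length p"
    unfolding OPT_def using p(1) by (intro Least_le) blast
  \<comment> \<open>\<open>exc_edge\<close> already subtracts 2, which leaves 1 of the 3.\<close>
  then have "int (OPT (del_edge G u v) u v) \<le> int (card (pverts G)) + exc_edge G u v - 1"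
    using p(2) by (simp add: exc_edge_def min)
  then show ?thesis using walk by blast
qed

end
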